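(* Let $\alpha,\beta\in\mathcal{ODCT}_n$ be such that $\alpha=\begin{pmatrix} A_1 & A_2\\ 1 & 2\end{pmatrix}$, i.e. $\alpha$ has image $\{1,2\}$ and kernel classes $A_1<A_2$ with $A_1\alpha=\{1\}$, $A_2\alpha=\{2\}$. Then $\alpha\le\beta$ if and only if $(\max A_1)\beta=1$ and $(\min A_2)\beta=2$.
   Context: $[n]=\{1,2,\ldots,n\}$ with its usual order. Maps are written on the right of their arguments. $\mathcal{ODCT}_n$ is the semigroup (under composition, $x(\alpha\beta)=(x\alpha)\beta$) of all maps $\alpha:[n]\to[n]$ that are contractions ($|x\alpha-y\alpha|\le|x-y|$ for all $x,y\in[n]$), order-preserving ($x\le y\Rightarrow x\alpha\le y\alpha$) and order-decreasing ($x\alpha\le x$ for all $x\in[n]$). The kernel classes of $\alpha$ are the equivalence classes of $\{(u,v): u\alpha=v\alpha\}$; $A<B$ means every element of $A$ is less than every element of $B$. The natural partial order on a semigroup $S$: $\alpha\le\beta$ iff there exist $\lambda,\mu\in S^1$ with $\alpha=\lambda\beta=\beta\mu$ and $\alpha=\alpha\mu$; here $S=\mathcal{ODCT}_n$. *)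

theory Defs
  imports Main "HOL-Library.FuncSet"
begin

text \<open>
  A semigroup is given by its carrier \<open>S\<close> and its multiplication \<open>m\<close>. The set \<open>S\<^sup>1\<close> is
  represented inside the option type: \<open>Some x\<close> is the element \<open>x\<close> of \<open>S\<close>, and \<open>None\<close>
  is an identity, adjoined only if \<open>S\<close> does not already have one.
\<close>

definition adjoin_one :: "'a set \<Rightarrow> ('a \<Rightarrow> 'a \<Rightarrow> 'a) \<Rightarrow> 'a option set" where
  "adjoin_one S m =
     (if \<exists>e\<in>S. \<forall>x\<in>S. m e x = x \<and> m x e = x then Some ` S else insert None (Some ` S))"

fun mult_one :: "('a \<Rightarrow> 'a \<Rightarrow> 'a) \<Rightarrow> 'a option \<Rightarrow> 'a option \<Rightarrow> 'a option" where
  "mult_one m None y = y"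
| "mult_one m (Some x) None = Some x"
| "mult_one m (Some x) (Some y) = Some (m x y)"

definition natural_le :: "'a set \<Rightarrow> ('a \<Rightarrow> 'a \<Rightarrow> 'a) \<Rightarrow> 'a \<Rightarrow> 'a \<Rightarrow> bool" where
  "natural_le S m a b \<longleftrightarrow>
     (\<exists>l \<in> adjoin_one S m. \<exists>r \<in> adjoin_one S m.
        Some a = mult_one m l (Some b) \<and>
        Some a = mult_one m (Some b) r \<and>
        Some a = mult_one m (Some a) r)"

text \<open>
  Maps on \<open>[n] = {1..n}\<close> are extensional functions, so that equality of functions is
  equality of maps on \<open>[n]\<close>. Distances are taken in the integers, since subtraction of
  natural numbers truncates.
\<close>

definition contraction_on :: "nat set \<Rightarrow> (nat \<Rightarrow> nat) \<Rightarrow> bool" where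
  "contraction_on X f \<longleftrightarrow>
     (\<forall>x\<in>X. \<forall>y\<in>X. \<bar>int (f x) - int (f y)\<bar> \<le> \<bar>int x - int y\<bar>)"

definition order_decreasing_on :: "nat set \<Rightarrow> (nat \<Rightarrow> nat) \<Rightarrow> bool" where
  "order_decreasing_on X f \<longleftrightarrow> (\<forall>x\<in>X. f x \<le> x)"

definition ODCT :: "nat \<Rightarrow> (nat \<Rightarrow> nat) set" where
  "ODCT n = {f \<in> {1..n} \<rightarrow>\<^sub>E {1..n}.
     contraction_on {1..n} f \<and> mono_on {1..n} f \<and> order_decreasing_on {1..n} f}"

text \<open>Maps act on the right, so the product \<open>f g\<close> applies \<open>f\<close> first.\<close>

definition rcomp :: "nat \<Rightarrow> (nat \<Rightarrow> nat) \<Rightarrow> (nat \<Rightarrow> nat) \<Rightarrow> nat \<Rightarrow> nat" where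
  "rcomp n f g = compose {1..n} g f"

lemma rcomp_closed:
  assumes "f \<in> ODCT n" and "g \<in> ODCT n"
  shows "rcomp n f g \<in> ODCT n"
proof -
  have f: "f x \<in> {1..n}" if "x \<in> {1..n}" for x
    using assms(1) that unfolding ODCT_def by blast
  have "rcomp n f g \<in> {1..n} \<rightarrow>\<^sub>E {1..n}"
  proof (rule PiE_I)
    fix x assume x: "x \<in> {1..n}"
    have "g (f x) \<in> {1..n}"
      using assms(2) f[OF x] unfolding ODCT_def by blast
    then show "rcomp n f g x \<in> {1..n}"
      using x by (simp add: rcomp_def compose_def)
  qed (auto simp: rcomp_def compose_def restrict_def)
  moreover have "contraction_on {1..n} (rcomp n f g)"
    unfolding contraction_on_def
  proof (intro ballI)
    fix x y assume xy: "x \<in> {1..n}" "y \<in> {1..n}"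
    have "\<bar>int (g (f x)) - int (g (f y))\<bar> \<le> \<bar>int (f x) - int (f y)\<bar>"
      using assms(2) f xy unfolding ODCT_def contraction_on_def by blast
    also have "\<dots> \<le> \<bar>int x - int y\<bar>"
      using assms(1) xy unfolding ODCT_def contraction_on_def by blast
    finally show "\<bar>int (rcomp n f g x) - int (rcomp n f g y)\<bar> \<le> \<bar>int x - int y\<bar>"
      using xy by (simp add: rcomp_def compose_def)
  qed
  moreover have "mono_on {1..n} (rcomp n f g)"
  proof (rule mono_onI)
    fix x y assume xy: "x \<in> {1..n}" "y \<in> {1..n}" "x \<le> y"
    have "f x \<le> f y"
      using assms(1) xy unfolding ODCT_def by (blast dest: mono_onD)
    then have "g (f x) \<le> g (f y)"
      using assms(2) f xy(1,2) unfolding ODCT_def by (blast dest: mono_onD)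
    then show "rcomp n f g x \<le> rcomp n f g y"
      using xy(1,2) by (simp add: rcomp_def compose_def)
  qed
  moreover have "order_decreasing_on {1..n} (rcomp n f g)"
    unfolding order_decreasing_on_def
  proof
    fix x assume x: "x \<in> {1..n}"
    have "g (f x) \<le> f x"
      using assms(2) f[OF x] unfolding ODCT_def order_decreasing_on_def by blast
    also have "\<dots> \<le> x"
      using assms(1) x unfolding ODCT_def order_decreasing_on_def by blast
    finally show "rcomp n f g x \<le> x"
      using x by (simp add: rcomp_def compose_def)
  qed
  ultimately show ?thesis by (simp add: ODCT_def)
qed

lemma rcomp_assoc:
  assumes "f \<in> ODCT n"
  shows "rcomp n (rcomp n f g) h = rcomp n f (rcomp n g h)"
proof -
  have "f \<in> {1..n} \<rightarrow> {1..n}"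
    using assms unfolding ODCT_def by blast
  then show ?thesis
    unfolding rcomp_def by (rule compose_assoc)
qed

abbreviation ODCT_le :: "nat \<Rightarrow> (nat \<Rightarrow> nat) \<Rightarrow> (nat \<Rightarrow> nat) \<Rightarrow> bool" where
  "ODCT_le n \<equiv> natural_le (ODCT n) (rcomp n)"

definition ker_rel :: "nat \<Rightarrow> (nat \<Rightarrow> nat) \<Rightarrow> (nat \<times> nat) set" where
  "ker_rel n f = {(u, v). u \<in> {1..n} \<and> v \<in> {1..n} \<and> f u = f v}"

definition kernel_classes :: "nat \<Rightarrow> (nat \<Rightarrow> nat) \<Rightarrow> nat set set" where
  "kernel_classes n f = {1..n} // ker_rel n f"

end

theory Submission
  imports Defs
begin

text \<open>
  Two facts reduce the theorem to a short computation. First, the identity map of \<open>[n]\<close> belongs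
  to \<open>ODCT n\<close>, so the factors witnessing the natural partial order can be taken in \<open>ODCT n\<close>
  itself. Second, the kernel classes \<open>A1 < A2\<close> partition \<open>[n]\<close>, so they are the initial segment
  ending in some \<open>p\<close> and the final segment beginning with \<open>Suc p\<close>.

  If \<open>\<alpha> \<le> \<beta>\<close>, then the right factor \<open>\<mu>\<close> satisfies \<open>\<alpha> \<mu> = \<alpha>\<close>, so it fixes both
  points \<open>1\<close> and \<open>2\<close> of the image of \<open>\<alpha>\<close>. As \<open>\<mu>\<close> is monotone and \<open>\<beta> \<mu> = \<alpha>\<close> sends
  \<open>p\<close> to \<open>1\<close>, the value of \<open>\<beta>\<close> at \<open>p\<close> lies below \<open>2\<close>. The value at \<open>Suc p\<close> is not
  \<open>1\<close>, because \<open>\<mu>\<close> sends it to \<open>2\<close>, and it is at most one larger than the value at \<open>p\<close>,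
  because \<open>\<beta>\<close> is a contraction.

  Conversely, both factors can be chosen among the truncations \<open>x \<mapsto> min x k\<close>. Truncating at
  \<open>Suc p\<close> before applying \<open>\<beta>\<close> leaves only arguments with values \<open>1\<close> and \<open>2\<close>; truncating at
  \<open>2\<close> after applying \<open>\<beta>\<close> reduces all values on \<open>A2\<close> to \<open>2\<close>.
\<close>

lemma natural_le_of_identity:
  assumes "e \<in> S" and "\<And>x. x \<in> S \<Longrightarrow> m e x = x" and "\<And>x. x \<in> S \<Longrightarrow> m x e = x"
  shows "natural_le S m a b \<longleftrightarrow> (\<exists>l\<in>S. \<exists>r\<in>S. a = m l b \<and> a = m b r \<and> a = m a r)"
proof -
  have "adjoin_one S m = Some ` S"
    using assms unfolding adjoin_one_def by auto
  then show ?thesis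
    by (simp add: natural_le_def)
qed

lemma rcomp_apply: "x \<in> {1..n} \<Longrightarrow> rcomp n f g x = g (f x)"
  by (simp add: rcomp_def compose_eq)

lemma rcomp_extensional: "rcomp n f g \<in> extensional {1..n}"
  by (simp add: rcomp_def)

lemma ODCT_extensional: "f \<in> ODCT n \<Longrightarrow> f \<in> extensional {1..n}"
  by (simp add: ODCT_def PiE_def)

text \<open>
  These maps supply every element of \<open>ODCT n\<close> that has to be constructed: the identity
  (for large \<open>k\<close>) and both factors in the criterion.
\<close>

lemma truncation_in_ODCT:
  assumes "1 \<le> k"
  shows "(\<lambda>x\<in>{1..n}. min x k) \<in> ODCT n"
  using assms
  by (auto simp: ODCT_def contraction_on_def order_decreasing_on_def mono_on_def)

lemma ODCT_le_iff:
  "ODCT_le n \<alpha> \<beta> \<longleftrightarrow>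
    (\<exists>l\<in>ODCT n. \<exists>r\<in>ODCT n. \<alpha> = rcomp n l \<beta> \<and> \<alpha> = rcomp n \<beta> r \<and> \<alpha> = rcomp n \<alpha> r)"
proof (rule natural_le_of_identity)
  \<comment> \<open>Truncating at \<open>Suc n\<close> rather than at \<open>n\<close> gives the identity also when \<open>n = 0\<close>.\<close>
  let ?e = "\<lambda>x\<in>{1..n}. min x (Suc n)"
  show "?e \<in> ODCT n"
    by (rule truncation_in_ODCT) simp
  fix f assume f: "f \<in> ODCT n"
  have f_in: "f x \<in> {1..n}" if "x \<in> {1..n}" for x
    using f that unfolding ODCT_def by blast
  note ext = extensionalityI[OF rcomp_extensional ODCT_extensional[OF f]]
  show "rcomp n ?e f = f"
    by (rule ext) (simp add: rcomp_apply)
  show "rcomp n f ?e = f"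
  proof (rule ext)
    fix x assume x: "x \<in> {1..n}"
    then show "rcomp n f ?e x = f x"
      using f_in[OF x] by (simp add: rcomp_apply)
  qed
qed

lemma Union_kernel_classes: "\<Union> (kernel_classes n f) = {1..n}"
proof -
  have "equiv {1..n} (ker_rel n f)"
    by (rule equivI) (auto simp: ker_rel_def refl_on_def sym_def trans_def)
  then show ?thesis
    unfolding kernel_classes_def by (rule Union_quotient)
qed

text \<open>
  A gap between the two blocks would have to lie in one of them, so a partition of an interval
  into two blocks \<open>A < B\<close> is a cut between consecutive points.
\<close>

lemma ordered_bipartition_is_cut:
  fixes A B :: "nat set"
  assumes un: "A \<union> B = {1..n}" and less: "\<forall>a\<in>A. \<forall>b\<in>B. a < b"
    and ne: "A \<noteq> {}" "B \<noteq> {}"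
  shows "A = {1..Max A}" and "B = {Suc (Max A)..n}" and "Min B = Suc (Max A)"
proof -
  have fin: "finite A" "finite B"
    using un by (metis finite_Un finite_atLeastAtMost)+
  have p: "Max A \<in> A"
    using fin ne by simp
  have A_le: "a \<le> Max A" if "a \<in> A" for a
    using fin that by simp
  have B_gt: "Max A < b" if "b \<in> B" for b
    using less p that by blast
  have cut: "x \<in> A \<longleftrightarrow> x \<le> Max A" "x \<in> B \<longleftrightarrow> Max A < x" if "x \<in> {1..n}" for x
  proof -
    have "x \<in> A \<or> x \<in> B"
      using that un by blast
    then show "x \<in> A \<longleftrightarrow> x \<le> Max A" "x \<in> B \<longleftrightarrow> Max A < x"
      using A_le[of x] B_gt[of x] by linarith+
  qed
  have range: "1 \<le> x" "x \<le> n" if "x \<in> A \<union> B" for x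
    using that unfolding un by simp_all
  have "Max A \<le> n"
    using range p by simp
  then show A: "A = {1..Max A}"
    using cut(1) range(1) A_le by (intro equalityI subsetI) simp_all
  show B: "B = {Suc (Max A)..n}"
    using cut(2) range(2) B_gt by (intro equalityI subsetI) (simp_all add: Suc_le_eq)
  show "Min B = Suc (Max A)"
  proof (rule Min_eqI)
    show "Suc (Max A) \<in> B"
      using B ne(2) by (metis atLeastatMost_empty_iff atLeastAtMost_iff order_refl)
  qed (use fin B in auto)
qed

text \<open>
  The right factor of \<open>\<alpha> \<le> \<beta>\<close> fixes \<open>1\<close> and \<open>2\<close>, which pins down \<open>\<beta>\<close> at the cut point
  and its successor; conversely, these two values of the monotone map \<open>\<beta>\<close> force it to be \<open>1\<close>
  up to \<open>p\<close> and at least \<open>2\<close> beyond, so truncations turn it into \<open>\<alpha>\<close>.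
\<close>

lemma ODCT_le_two_step_iff:
  assumes \<alpha>: "\<alpha> \<in> ODCT n" and \<beta>: "\<beta> \<in> ODCT n"
    and p: "1 \<le> p" "p < n"
    and one: "\<And>x. x \<in> {1..p} \<Longrightarrow> \<alpha> x = 1"
    and two: "\<And>x. x \<in> {Suc p..n} \<Longrightarrow> \<alpha> x = 2"
  shows "ODCT_le n \<alpha> \<beta> \<longleftrightarrow> \<beta> p = 1 \<and> \<beta> (Suc p) = 2"
proof
  have \<beta>_in: "\<beta> x \<in> {1..n}" if "x \<in> {1..n}" for x
    using \<beta> that unfolding ODCT_def by blast
  have \<beta>_mono: "\<beta> x \<le> \<beta> y" if "x \<in> {1..n}" "y \<in> {1..n}" "x \<le> y" for x y
    using \<beta> that unfolding ODCT_def by (blast dest: mono_onD)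
  {
    assume "ODCT_le n \<alpha> \<beta>"
    then obtain r where r: "r \<in> ODCT n" "\<alpha> = rcomp n \<beta> r" "\<alpha> = rcomp n \<alpha> r"
      unfolding ODCT_le_iff by blast
    have \<beta>r: "\<alpha> x = r (\<beta> x)" if "x \<in> {1..n}" for x
      using fun_cong[OF r(2), of x] that by (simp add: rcomp_apply)
    have \<alpha>r: "\<alpha> x = r (\<alpha> x)" if "x \<in> {1..n}" for x
      using fun_cong[OF r(3), of x] rcomp_apply[OF that, of \<alpha> r] by (rule trans)
    have r1: "r 1 = 1"
      using \<alpha>r[of p] one[of p] p by simp
    have r2: "r 2 = 2"
      using \<alpha>r[of "Suc p"] two[of "Suc p"] p by simp
    have rp: "r (\<beta> p) = 1"
      using \<beta>r[of p] one[of p] p by simp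
    have rq: "r (\<beta> (Suc p)) = 2"
      using \<beta>r[of "Suc p"] two[of "Suc p"] p by simp
    have "mono_on {1..n} r"
      using r(1) by (simp add: ODCT_def)
    then have "\<not> 2 \<le> \<beta> p"
      using mono_onD[of "{1..n}" r 2 "\<beta> p"] \<beta>_in[of p] r2 rp p by auto
    then have \<beta>p: "\<beta> p = 1"
      using \<beta>_in[of p] p by auto
    have "\<bar>int (\<beta> (Suc p)) - int (\<beta> p)\<bar> \<le> \<bar>int (Suc p) - int p\<bar>"
      using \<beta> p unfolding ODCT_def contraction_on_def
      by (metis (mono_tags, lifting) Suc_leI atLeastAtMost_iff le_SucI less_imp_le mem_Collect_eq)
    moreover have "\<beta> (Suc p) \<noteq> 1"
      using r1 rq by auto
    ultimately have "\<beta> (Suc p) = 2"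
      using \<beta>p \<beta>_in[of "Suc p"] p by auto
    with \<beta>p show "\<beta> p = 1 \<and> \<beta> (Suc p) = 2" ..
  }
  {
    assume \<beta>pq: "\<beta> p = 1 \<and> \<beta> (Suc p) = 2"
    let ?l = "\<lambda>x\<in>{1..n}. min x (Suc p)" and ?r = "\<lambda>x\<in>{1..n}. min x 2"
    have low: "\<beta> x = 1" if "x \<in> {1..p}" for x
      using \<beta>_mono[of x p] \<beta>_in[of x] \<beta>pq p that by auto
    have high: "2 \<le> \<beta> x" if "x \<in> {Suc p..n}" for x
      using \<beta>_mono[of "Suc p" x] \<beta>pq p that by auto
    have step: "\<alpha> x = rcomp n ?l \<beta> x \<and> \<alpha> x = rcomp n \<beta> ?r x \<and> \<alpha> x = rcomp n \<alpha> ?r x"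
      if "x \<in> {1..n}" for x
    proof (cases "x \<le> p")
      case True
      then show ?thesis
        using one[of x] low[of x] p that by (simp add: rcomp_apply)
    next
      case False
      then have "\<alpha> x = 2" "2 \<le> \<beta> x"
        using two[of x] high[of x] that by simp_all
      then show ?thesis
        using False \<beta>_in[OF that] \<beta>pq p that by (simp add: rcomp_apply min_absorb2)
    qed
    have "\<alpha> = rcomp n ?l \<beta>" "\<alpha> = rcomp n \<beta> ?r" "\<alpha> = rcomp n \<alpha> ?r"
      by (rule extensionalityI[OF ODCT_extensional[OF \<alpha>] rcomp_extensional]; use step in blast)+
    moreover have "?l \<in> ODCT n" "?r \<in> ODCT n"
      by (rule truncation_in_ODCT; simp)+
    ultimately show "ODCT_le n \<alpha> \<beta>"
      unfolding ODCT_le_iff by blast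
  }
qed

theorem corollary29:
  fixes n :: nat and \<alpha> \<beta> :: "nat \<Rightarrow> nat" and A1 A2 :: "nat set"
  assumes "\<alpha> \<in> ODCT n" and "\<beta> \<in> ODCT n"
    and "\<alpha> ` {1..n} = {1, 2}"
    and "kernel_classes n \<alpha> = {A1, A2}"
    and "\<forall>a\<in>A1. \<forall>b\<in>A2. a < b"
    and "\<alpha> ` A1 = {1}" and "\<alpha> ` A2 = {2}"
  shows "ODCT_le n \<alpha> \<beta> \<longleftrightarrow> \<beta> (Max A1) = 1 \<and> \<beta> (Min A2) = 2"
proof -
  have un: "A1 \<union> A2 = {1..n}"
    using Union_kernel_classes[of n \<alpha>] assms(4) by simp
  have ne: "A1 \<noteq> {}" "A2 \<noteq> {}"
    using assms(6,7) by auto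
  note cut = ordered_bipartition_is_cut[OF un assms(5) ne]
  have "1 \<le> Max A1" "Max A1 < n"
    using cut(1,2) ne by (metis atLeastatMost_empty_iff Suc_le_eq)+
  moreover have "\<alpha> x = 1" if "x \<in> {1..Max A1}" for x
    using assms(6) cut(1) that by blast
  moreover have "\<alpha> x = 2" if "x \<in> {Suc (Max A1)..n}" for x
    using assms(7) cut(2) that by blast
  ultimately have "ODCT_le n \<alpha> \<beta> \<longleftrightarrow> \<beta> (Max A1) = 1 \<and> \<beta> (Suc (Max A1)) = 2"
    by (rule ODCT_le_two_step_iff[OF assms(1,2)])
  then show ?thesis
    by (simp only: cut(3))
qed

end
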